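(* Let $X$ be a real Hilbert space, let $T\colon X\to X$ be firmly nonexpansive, let $A\colon X\rightrightarrows X$ be maximally monotone, and suppose that $T=J_A$, or equivalently that $A=T^{-1}-\mathrm{Id}$. Then the following are equivalent: (i) $T$ is linear. (ii) $A$ is a linear relation. (iii) $\mathrm{Id}-T$ is linear. (iv) $A^{-1}$ is a linear relation. Consequently, linearity is a self-dual property for firmly nonexpansive mappings; correspondingly, being a linear relation is a self-dual property for maximally monotone operators.
   Context: $X$ is a real Hilbert space; $\mathrm{Id}$ is the identity on $X$. $T\colon X\to X$ is firmly nonexpansive if $\|Tx-Ty\|^2+\|(\mathrm{Id}-T)x-(\mathrm{Id}-T)y\|^2\leq\|x-y\|^2$ for all $x,y\in X$. For $A\colon X\rightrightarrows X$ (so $Ax\subseteq X$ for each $x$): $\operatorname{gr}A=\{(x,u):u\in Ax\}$ and $x\in A^{-1}u\Leftrightarrow u\in Ax$. $A$ is monotone if $\langle x-y,u-v\rangle\geq0$ for all $(x,u),(y,v)\in\operatorname{gr}A$, and maximally monotone if it is monotone with no proper monotone extension. $A$ is a linear relation if $\operatorname{gr}A$ is a linear subspace of $X\times X$. The resolvent of a maximally monotone $A$ is $J_A=(\mathrm{Id}+A)^{-1}\colon X\to X$. A property of firmly nonexpansive mappings on $X$ is self-dual if, for every firmly nonexpansive $T\colon X\to X$, $T$ has it if and only if $\mathrm{Id}-T$ has it; a property of maximally monotone operators on $X$ is self-dual if, for every maximally monotone $A$, $A$ has it if and only if $A^{-1}$ has it. *)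

theory Defs
  imports "HOL-Analysis.Analysis"
begin

text \<open>
  A set-valued operator on \<open>X\<close> is a function \<open>'a \<Rightarrow> 'a set\<close>. A real Hilbert space is a type of
  class \<open>{real_inner, complete_space}\<close>; completeness is only imposed where it is needed.
\<close>

definition firmly_nonexpansive :: "('a::real_inner \<Rightarrow> 'a) \<Rightarrow> bool" where
  "firmly_nonexpansive T \<longleftrightarrow>
     (\<forall>x y. (norm (T x - T y))\<^sup>2 + (norm ((x - T x) - (y - T y)))\<^sup>2 \<le> (norm (x - y))\<^sup>2)"

definition op_graph :: "('a \<Rightarrow> 'a set) \<Rightarrow> ('a \<times> 'a) set" where
  "op_graph A = {(x, u). u \<in> A x}"

definition op_inverse :: "('a \<Rightarrow> 'a set) \<Rightarrow> 'a \<Rightarrow> 'a set" where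
  "op_inverse A u = {x. u \<in> A x}"

text \<open>A map \<open>T : X \<rightarrow> X\<close> is identified with the operator whose values are the singletons \<open>{T x}\<close>.\<close>

definition single_valued_op :: "('a \<Rightarrow> 'a) \<Rightarrow> 'a \<Rightarrow> 'a set" where
  "single_valued_op T x = {T x}"

text \<open>Pointwise Minkowski sum and difference. The library's \<open>-\<close> on sets is set difference, so it
  cannot be used for the latter.\<close>

definition op_add :: "('a::real_vector \<Rightarrow> 'a set) \<Rightarrow> ('a \<Rightarrow> 'a set) \<Rightarrow> 'a \<Rightarrow> 'a set" where
  "op_add A B x = {u + v | u v. u \<in> A x \<and> v \<in> B x}"

definition op_diff :: "('a::real_vector \<Rightarrow> 'a set) \<Rightarrow> ('a \<Rightarrow> 'a set) \<Rightarrow> 'a \<Rightarrow> 'a set" where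
  "op_diff A B x = {u - v | u v. u \<in> A x \<and> v \<in> B x}"

definition monotone_operator :: "('a::real_inner \<Rightarrow> 'a set) \<Rightarrow> bool" where
  "monotone_operator A \<longleftrightarrow>
     (\<forall>(x, u) \<in> op_graph A. \<forall>(y, v) \<in> op_graph A. (x - y) \<bullet> (u - v) \<ge> 0)"

definition maximally_monotone :: "('a::real_inner \<Rightarrow> 'a set) \<Rightarrow> bool" where
  "maximally_monotone A \<longleftrightarrow>
     monotone_operator A \<and> \<not> (\<exists>B. monotone_operator B \<and> op_graph A \<subset> op_graph B)"

definition linear_relation :: "('a::real_vector \<Rightarrow> 'a set) \<Rightarrow> bool" where
  "linear_relation A \<longleftrightarrow> subspace (op_graph A)"

text \<open>The resolvent is kept set-valued; for maximally monotone \<open>A\<close> on a Hilbert space all its values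
  are singletons, and \<open>T = J\<^sub>A\<close> reads \<open>single_valued_op T = resolvent A\<close>.\<close>

definition resolvent :: "('a::real_vector \<Rightarrow> 'a set) \<Rightarrow> 'a \<Rightarrow> 'a set" where
  "resolvent A = op_inverse (op_add (single_valued_op id) A)"

definition self_dual_firmly_nonexpansive :: "(('a::real_inner \<Rightarrow> 'a) \<Rightarrow> bool) \<Rightarrow> bool" where
  "self_dual_firmly_nonexpansive P \<longleftrightarrow>
     (\<forall>T. firmly_nonexpansive T \<longrightarrow> (P T \<longleftrightarrow> P (\<lambda>x. x - T x)))"

definition self_dual_maximally_monotone :: "(('a::real_inner \<Rightarrow> 'a set) \<Rightarrow> bool) \<Rightarrow> bool" where
  "self_dual_maximally_monotone P \<longleftrightarrow>
     (\<forall>A. maximally_monotone A \<longrightarrow> (P A \<longleftrightarrow> P (op_inverse A)))"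

end

theory Submission
  imports Defs
begin

text \<open>The graphs of \<open>A\<close> and \<open>T = J\<^sub>A\<close> are exchanged by the linear change of variables
  \<open>(z, u) \<mapsto> (z + u, z)\<close>, and the graphs of \<open>A\<close> and \<open>A\<inverse>\<close> by the linear swap of coordinates;
  such maps preserve subspaces.\<close>

lemma mem_resolvent_iff: "z \<in> resolvent A x \<longleftrightarrow> x - z \<in> A z"
  unfolding resolvent_def op_inverse_def op_add_def single_valued_op_def
  by (auto simp: algebra_simps intro: exI[of _ "x - z"])

text \<open>Substituting \<open>x = z + u\<close> in \<open>x - z \<in> A z\<close> replaces the
  resolvent by one equation that describes gr A in terms of \<open>T\<close>; the later arguments
  use \<open>T = J_A\<close> in this form.\<close>

lemma single_valued_op_eq_resolvent_iff:
  "single_valued_op T = resolvent A \<longleftrightarrow> (\<forall>z u. u \<in> A z \<longleftrightarrow> T (z + u) = z)"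
proof -
  have "single_valued_op T = resolvent A \<longleftrightarrow> (\<forall>x z. z = T x \<longleftrightarrow> x - z \<in> A z)"
    by (simp add: fun_eq_iff set_eq_iff mem_resolvent_iff single_valued_op_def)
  also have "\<dots> \<longleftrightarrow> (\<forall>z u. u \<in> A z \<longleftrightarrow> T (z + u) = z)"
    by (metis add_diff_cancel_left' diff_add_cancel add.commute)
  finally show ?thesis .
qed

text \<open>An element of \<open>T\<close>-inverse minus Id at \<open>z\<close> is
  \<open>x - z\<close> with \<open>T x = z\<close>, so the only possible witness for
  \<open>u\<close> is \<open>x = z + u\<close>.\<close>

lemma mem_op_diff_inverse_id_iff:
  "u \<in> op_diff (op_inverse (single_valued_op T)) (single_valued_op id) z \<longleftrightarrow> T (z + u) = z"
  unfolding op_diff_def op_inverse_def single_valued_op_def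
  by (auto simp: algebra_simps intro!: exI[of _ "z + u"])

lemma single_valued_op_eq_resolvent_iff_op_diff:
  "single_valued_op T = resolvent A \<longleftrightarrow>
     A = op_diff (op_inverse (single_valued_op T)) (single_valued_op id)"
  unfolding single_valued_op_eq_resolvent_iff
  by (auto simp: fun_eq_iff set_eq_iff mem_op_diff_inverse_id_iff)

lemma linear_iff_linear_relation_of_resolvent:
  assumes "single_valued_op T = resolvent A"
  shows "linear T \<longleftrightarrow> linear_relation A"
proof -
  have graph: "(z, u) \<in> op_graph A \<longleftrightarrow> T (z + u) = z" for z u
    using assms by (simp add: single_valued_op_eq_resolvent_iff op_graph_def)
  show ?thesis
  proof
    assume T: "linear T"
    show "linear_relation A"
      unfolding linear_relation_def
    proof (rule subspaceI)
      show "0 \<in> op_graph A"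
        using linear_0[OF T] by (simp add: graph zero_prod_def)
      \<comment> \<open>The point of the domain of \<open>T\<close> that corresponds to a pair
        \<open>(z, u)\<close> is \<open>z + u\<close>, hence additivity is applied at the coordinate
        sums.\<close>
      show "p + q \<in> op_graph A" if "p \<in> op_graph A" "q \<in> op_graph A" for p q
        using that linear_add[OF T, of "fst p + snd p" "fst q + snd q"]
        by (cases p; cases q) (simp add: graph algebra_simps)
      show "c *\<^sub>R p \<in> op_graph A" if "p \<in> op_graph A" for c p
        using that linear_scale[OF T, of c "fst p + snd p"]
        by (cases p) (simp add: graph scaleR_right_distrib)
    qed
  next
    assume "linear_relation A"
    then have S: "subspace (op_graph A)"
      by (simp add: linear_relation_def)
    \<comment> \<open>Minty parametrization: \<open>x\<close> splits into a point of gr A. Adding or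
      scaling such points inside the subspace and reading the result through \<open>graph\<close>
      gives the linearity equations for \<open>T\<close>.\<close>
    have mem: "(T x, x - T x) \<in> op_graph A" for x
      by (simp add: graph)
    show "linear T"
    proof (rule linearI)
      show "T (x + y) = T x + T y" for x y
        using subspace_add[OF S mem[of x] mem[of y]] by (simp add: graph algebra_simps)
      show "T (c *\<^sub>R x) = c *\<^sub>R T x" for c x
        using subspace_scale[OF S mem[of x], of c] by (simp add: graph algebra_simps)
    qed
  qed
qed

text \<open>The passage from \<open>T\<close> to Id - \<open>T\<close> is an involution that
  preserves linearity.\<close>

lemma linear_id_minus_iff: "linear (\<lambda>x. x - T x) \<longleftrightarrow> linear T"
proof
  assume "linear (\<lambda>x. x - T x)"
  from linear_compose_sub[OF linear_ident this] show "linear T" by simp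
qed (rule linear_compose_sub[OF linear_ident])

lemma op_graph_op_inverse: "op_graph (op_inverse A) = prod.swap ` op_graph A"
  by (auto simp: op_graph_def op_inverse_def image_iff)

lemma op_inverse_op_inverse: "op_inverse (op_inverse A) = A"
  by (simp add: op_inverse_def fun_eq_iff)

lemma linear_relation_op_inverse_iff: "linear_relation (op_inverse A) \<longleftrightarrow> linear_relation A"
proof -
  have swap: "linear (prod.swap :: 'a \<times> 'a \<Rightarrow> 'a \<times> 'a)"
    by (rule linearI) auto
  \<comment> \<open>One implication for arbitrary \<open>B\<close> suffices: taking \<open>B\<close>
    to be the inverse of \<open>A\<close> yields the converse.\<close>
  have "linear_relation (op_inverse B)" if "linear_relation B" for B :: "'a \<Rightarrow> 'a set"
    using that linear_subspace_image[OF swap]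
    by (simp add: linear_relation_def op_graph_op_inverse)
  from this[of A] this[of "op_inverse A"] show ?thesis
    by (auto simp: op_inverse_op_inverse)
qed

theorem theorem3p15:
  shows "(\<forall>(T :: 'a::{real_inner,complete_space} \<Rightarrow> 'a) (A :: 'a \<Rightarrow> 'a set).
            firmly_nonexpansive T \<longrightarrow> maximally_monotone A \<longrightarrow>
              (single_valued_op T = resolvent A \<longleftrightarrow>
                 A = op_diff (op_inverse (single_valued_op T)) (single_valued_op id)) \<and>
              (single_valued_op T = resolvent A \<longrightarrow>
                 (linear T \<longleftrightarrow> linear_relation A) \<and>
                 (linear_relation A \<longleftrightarrow> linear (\<lambda>x. x - T x)) \<and>
                 (linear (\<lambda>x. x - T x) \<longleftrightarrow> linear_relation (op_inverse A))))
       \<and> self_dual_firmly_nonexpansive (linear :: ('a \<Rightarrow> 'a) \<Rightarrow> bool)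
       \<and> self_dual_maximally_monotone (linear_relation :: ('a \<Rightarrow> 'a set) \<Rightarrow> bool)"
  \<comment> \<open>The resolvent lemma links (i) with (ii); the two involution lemmas link (i) with
    (iii) and (ii) with (iv), and also give the self-duality claims.\<close>
  unfolding self_dual_firmly_nonexpansive_def self_dual_maximally_monotone_def
  using single_valued_op_eq_resolvent_iff_op_diff linear_iff_linear_relation_of_resolvent
    linear_id_minus_iff linear_relation_op_inverse_iff
  by blast

end
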